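(* Let $s\ge 1$ be an integer. In the ring $\mathbb{R}[[z]]$ of formal power series, with $\Upsilon_s$, $\Lambda_s$, $\xi_s$ the polynomials $$\Upsilon_s(z)=\sum_{k=1}^{s}E(s,k)\,z^{k-1},\qquad \Lambda_s(z)=\sum_{k=1}^{s}E(s,k)\,z^{2k-1},\qquad \xi_s(z)=\sum_{k=1}^{s}E(s,k)\,(-1)^{k-1}z^{k-1},$$ where $E(s,k)$ are the Eulerian numbers, one has $$\frac{\Upsilon_s(z)}{(1-z)^{s+1}}-2^{s+1}\,\frac{\Lambda_s(z)}{(1-z)^{s+1}(1+z)^{s+1}}=\frac{\xi_s(z)}{(1+z)^{s+1}},$$ that is, $g(z)-2^{s+1}h(z)=\xi_s(z)(1+z)^{-s-1}$ with $g(z)=\Upsilon_s(z)(1-z)^{-s-1}$ and $h(z)=\Lambda_s(z)(1-z)^{-s-1}(1+z)^{-s-1}$. Moreover, the real number $C$ determined by $$C-2^{s+1}C=\frac{\xi_s(1)}{2^{s+1}},\qquad\text{i.e.}\qquad C=\frac{\xi_s(1)}{2^{s+1}(1-2^{s+1})},$$ satisfies $C=\zeta(-s)$.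
   Context: For integers $1\le k\le s$, $E(s,k)$ denotes the Eulerian number, indexed with rows $s$ and columns $k$ both starting from $1$: it is the number of permutations of $\{1,\dots,s\}$ with exactly $k-1$ descents (rows: $1$; $1,1$; $1,4,1$; $1,11,11,1$; $1,26,66,26,1$; ...). $\zeta$ is the (analytically continued) Riemann zeta function. Rational functions whose denominators have nonzero constant term are identified with their expansions in $\mathbb{R}[[z]]$. *)

theory Defs
  imports
    "HOL-Complex_Analysis.Complex_Analysis"
    "HOL-Combinatorics.Permutations"
    "HOL-Computational_Algebra.Computational_Algebra"
begin

(* The permutations of {1..s} with exactly k - 1 descents; only 1 \<le> k \<le> s is used
   (at k = 0 natural-number subtraction would give the same value as k = 1). *)
definition eulerian :: "nat \<Rightarrow> nat \<Rightarrow> nat" where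
  "eulerian s k =
     card {p. p permutes {1..s} \<and> card {i \<in> {1..<s}. p i > p (Suc i)} = k - 1}"

definition Upsilon :: "nat \<Rightarrow> real poly" where
  "Upsilon s = (\<Sum>k=1..s. monom (of_nat (eulerian s k)) (k - 1))"

definition Lambda :: "nat \<Rightarrow> real poly" where
  "Lambda s = (\<Sum>k=1..s. monom (of_nat (eulerian s k)) (2 * k - 1))"

definition xi :: "nat \<Rightarrow> real poly" where
  "xi s = (\<Sum>k=1..s. monom (of_nat (eulerian s k) * (- 1) ^ (k - 1)) (k - 1))"

(* Since - {1} is connected, the first two conditions determine f on - {1} by analytic
   continuation. The value at the pole is set to 0 by convention, so that f is unique
   as a total function. *)
definition riemann_zeta :: "complex \<Rightarrow> complex" where
  "riemann_zeta = (THE f.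
     f holomorphic_on - {1} \<and>
     (\<forall>w. Re w > 1 \<longrightarrow> (\<lambda>n. of_nat (Suc n) powr (- w)) sums f w) \<and>
     f 1 = 0)"

end

theory Submission
  imports Defs "HOL-Combinatorics.Multiset_Permutations"
begin

text \<open>Why the formal identity holds. The Eulerian polynomial is the numerator of the power series
  with coefficients \<open>(n + 1) ^ s\<close>
  (\<open>eulerian_poly_eq_power_series\<close>): inserting the largest entry into a permutation gives a
  differential recurrence for the polynomial (\<open>eulerian_poly_Suc\<close>) that matches the effect of
  \<open>f \<mapsto> (z f)'\<close> on that series. Since \<open>\<Lambda>(z) = z \<Upsilon>(z\<^sup>2)\<close> and \<open>\<xi>(z) = \<Upsilon>(- z)\<close>, the series
  \<open>h\<close> carries \<open>(n + 1) ^ s\<close> at the odd exponent \<open>2 n + 1\<close>, so that subtracting \<open>2 ^ (s + 1) h\<close> from \<open>g\<close>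
  subtracts twice the coefficient of \<open>g\<close> at every odd exponent; what remains is \<open>g(- z)\<close>.

  Why the number is a zeta value. By the first part, \<open>\<xi>(1) / 2 ^ (s + 1)\<close> is the Abel sum of
  \<open>1 ^ s - 2 ^ s + 3 ^ s - \<dots>\<close>. Expanding \<open>(n + 2) ^ s\<close> around \<open>n + 1\<close> by the binomial theorem gives a
  recurrence in \<open>s\<close> for these sums (\<open>abel_eta_recurrence\<close>). The same expansion with a complex
  exponent \<open>- w\<close>, a binomial series cut off after \<open>K\<close> terms, relates the Dirichlet series
  \<open>\<eta>(w) = \<Sum> (- 1) ^ n (n + 1) ^ (- w)\<close> to \<open>\<eta>(w + 1), \<eta>(w + 2), \<dots>\<close> and a remainder series that converges
  for \<open>Re w > - K\<close> (\<open>nat_power_difference_sums\<close>). Read from right to left, this relation continues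
  \<open>\<eta>\<close> to the left one strip at a time (\<open>entire_extension\<close>); at \<open>w = - s\<close> the binomial series
  terminates, the remainder vanishes, and the relation is the recurrence of the Abel sums.
  Hence \<open>\<eta>(- s)\<close> is the Abel sum (\<open>eta_extension\<close>).

  The same relation without signs continues \<open>(w - 1) \<zeta>(w)\<close> to an entire function
  (\<open>zeta_extension\<close>), which shows that the description that defines \<open>riemann_zeta\<close> has exactly one
  solution. The identity \<open>\<eta>(w) = (1 - 2 powr (1 - w)) \<zeta>(w)\<close>, clear where the series converge
  absolutely, extends to the punctured plane and is evaluated at \<open>w = - s\<close>.\<close>

section \<open>The Eulerian recurrence by inserting the maximum\<close>

fun descents :: "'a :: linorder list \<Rightarrow> nat" where
  "descents [] = 0"
| "descents [x] = 0"
| "descents (x # y # zs) = of_bool (x > y) + descents (y # zs)"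

fun insertions :: "'a \<Rightarrow> 'a list \<Rightarrow> 'a list list" where
  "insertions m [] = [[m]]"
| "insertions m (x # xs) = (m # x # xs) # map ((#) x) (insertions m xs)"

lemma descents_le: "descents xs \<le> length xs"
  by (induction xs rule: descents.induct) auto

text \<open>A maximal letter creates a new descent unless it is put inside an existing descent or at the
  very end. So of the \<open>length xs + 1\<close> positions exactly \<open>descents xs + 1\<close> keep the number of descents,
  and each of the others raises it by one.\<close>
lemma sum_power_descents_insertions:
  fixes z :: "'b :: comm_ring_1"
  assumes "\<forall>x\<in>set xs. x < m"
  shows "(\<Sum>ys\<leftarrow>insertions m xs. z ^ descents ys)
           = of_nat (Suc (descents xs)) * z ^ descents xs
             + of_nat (length xs - descents xs) * z ^ Suc (descents xs)"
  using assms
proof (induction xs rule: descents.induct)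
  case (3 x y zs)
  define d where "d = descents (y # zs)"
  define b :: nat where "b = of_bool (x > y)"
  \<comment> \<open>The insertions after \<open>y\<close>. Putting \<open>m\<close> directly before \<open>y\<close> behaves differently depending on
    whether something precedes \<open>y\<close>, so this part of the induction hypothesis is isolated.\<close>
  define T where "T = (\<Sum>ys\<leftarrow>insertions m zs. z ^ descents (y # ys))"
  have m: "\<not> m < x" "\<not> m < y" "x < m" "y < m" using 3 by auto
  have "descents (y # zs) \<le> length (y # zs)" by (rule descents_le)
  hence len: "of_nat (length (y # zs) - d) = (of_nat (length zs) + 1 - of_nat d :: 'b)"
    "of_nat (length (x # y # zs) - (b + d)) = (of_nat (length zs) + 2 - of_nat b - of_nat d :: 'b)"
    by (auto simp: d_def b_def of_nat_diff)
  have "z ^ Suc d + T = of_nat (Suc d) * z ^ d + of_nat (length (y # zs) - d) * z ^ Suc d"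
    using 3 by (simp add: d_def T_def o_def)
  hence T: "T = of_nat (Suc d) * z ^ d + (of_nat (length zs) - of_nat d) * z ^ Suc d"
    unfolding len by (simp add: algebra_simps)
  have "(\<Sum>ys\<leftarrow>insertions m (x # y # zs). z ^ descents ys)
      = z ^ Suc (b + d) + z ^ Suc d + z ^ b * T"
    using m by (simp add: d_def b_def T_def o_def power_add sum_list_const_mult)
  also have "\<dots> = of_nat (Suc (b + d)) * z ^ (b + d) +
      of_nat (length (x # y # zs) - (b + d)) * z ^ Suc (b + d)"
    unfolding len T by (cases "x > y") (simp_all add: b_def algebra_simps)
  finally show ?case by (simp add: d_def b_def)
qed auto

lemma distinct_insertions: "m \<notin> set xs \<Longrightarrow> distinct (insertions m xs)"
  by (induction xs) (auto simp: distinct_map inj_on_def)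

lemma set_insertions:
  "m \<notin> set xs \<Longrightarrow> set (insertions m xs) = {ys. m \<in> set ys \<and> remove1 m ys = xs}"
proof (induction xs)
  case Nil
  have "m \<in> set ys \<and> remove1 m ys = [] \<longleftrightarrow> ys = [m]" for ys
    by (cases ys) auto
  thus ?case by auto
next
  case (Cons x xs)
  have "m \<in> set ys \<and> remove1 m ys = x # xs \<longleftrightarrow> ys \<in> set (insertions m (x # xs))" for ys
    using Cons by (cases ys) auto
  thus ?case by blast
qed

text \<open>Deleting \<open>m\<close> maps the permutations of the larger set onto those of the smaller one, and the
  fibre over \<open>xs\<close> consists of the insertions of \<open>m\<close> into \<open>xs\<close>.\<close>
lemma sum_permutations_of_set_insert:
  fixes f :: "'a list \<Rightarrow> 'b :: comm_monoid_add"
  assumes "finite A" "m \<notin> A"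
  shows "(\<Sum>ys\<in>permutations_of_set (insert m A). f ys)
           = (\<Sum>xs\<in>permutations_of_set A. \<Sum>ys\<leftarrow>insertions m xs. f ys)"
proof -
  let ?P = "permutations_of_set (insert m A)"
  have "(\<Sum>ys\<in>?P. f ys) = (\<Sum>xs\<in>permutations_of_set A. sum f {ys \<in> ?P. remove1 m ys = xs})"
    using assms by (intro sum.group [symmetric] finite_permutations_of_set) (auto simp: permutations_of_set_def)
  also have "\<dots> = (\<Sum>xs\<in>permutations_of_set A. \<Sum>ys\<leftarrow>insertions m xs. f ys)"
  proof (rule sum.cong)
    fix xs assume "xs \<in> permutations_of_set A"
    hence xs: "set xs = A" "distinct xs" by (auto simp: permutations_of_set_def)
    hence m: "m \<notin> set xs" using assms by simp
    have "ys \<in> ?P \<and> remove1 m ys = xs \<longleftrightarrow> m \<in> set ys \<and> remove1 m ys = xs" for ys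
    proof safe
      assume ys: "m \<in> set ys" "xs = remove1 m ys"
      have "mset ys = add_mset m (mset xs)" using ys by simp
      hence "set ys = insert m A" "distinct ys"
        using xs m by (metis set_mset_add_mset_insert set_mset_mset, metis distinct.simps(2) mset.simps(2) mset_eq_imp_distinct_iff)
      thus "ys \<in> ?P" by (rule permutations_of_setI)
    qed (auto simp: permutations_of_set_def)
    hence "{ys \<in> ?P. remove1 m ys = xs} = set (insertions m xs)"
      unfolding set_insertions [OF m] by blast
    thus "sum f {ys \<in> ?P. remove1 m ys = xs} = (\<Sum>ys\<leftarrow>insertions m xs. f ys)"
      by (simp add: sum_list_distinct_conv_sum_set distinct_insertions [OF m])
  qed auto
  finally show ?thesis .
qed

text \<open>Defined by the permutations themselves rather than by the numbers \<open>eulerian s k\<close> with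
  \<open>1 \<le> k \<le> s\<close>, so that the empty permutation contributes and the value at \<open>s = 0\<close> is \<open>1\<close>.
  This is the value at which the recurrences below have to start.\<close>
definition eulerian_poly :: "nat \<Rightarrow> real poly" where
  "eulerian_poly s = (\<Sum>xs\<in>permutations_of_set {1..s}. monom 1 (descents xs))"

definition power_series :: "nat \<Rightarrow> real fps" where
  "power_series s = Abs_fps (\<lambda>n. real (Suc n) ^ s)"

lemma fps_eulerian_poly:
  "fps_of_poly (eulerian_poly s) = (\<Sum>xs\<in>permutations_of_set {1..s}. fps_X ^ descents xs)"
  by (simp add: eulerian_poly_def fps_of_poly_sum fps_of_poly_monom)

lemma eulerian_poly_Suc:
  fixes s :: nat
  defines "P \<equiv> fps_of_poly (eulerian_poly s)"
  shows "fps_of_poly (eulerian_poly (Suc s))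
           = (1 + of_nat s * fps_X) * P + fps_X * (1 - fps_X) * fps_deriv P"
proof -
  have "{1..Suc s} = insert (Suc s) {1..s}" by auto
  hence "fps_of_poly (eulerian_poly (Suc s))
     = (\<Sum>xs\<in>permutations_of_set {1..s}. \<Sum>ys\<leftarrow>insertions (Suc s) xs. fps_X ^ descents ys)"
    unfolding fps_eulerian_poly by (simp add: sum_permutations_of_set_insert)
  also have "\<dots> = (\<Sum>xs\<in>permutations_of_set {1..s}.
     (1 + of_nat s * fps_X) * fps_X ^ descents xs + fps_X * (1 - fps_X) * fps_deriv (fps_X ^ descents xs))"
  proof (rule sum.cong)
    fix xs assume xs: "xs \<in> permutations_of_set {1..s}"
    have len: "length xs = s" using length_finite_permutations_of_set [OF xs] by simp
    have "(\<Sum>ys\<leftarrow>insertions (Suc s) xs. (fps_X :: real fps) ^ descents ys) =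
       of_nat (Suc (descents xs)) * fps_X ^ descents xs
        + of_nat (length xs - descents xs) * fps_X ^ Suc (descents xs)"
      by (rule sum_power_descents_insertions) (use xs in \<open>auto simp: permutations_of_set_def\<close>)
    also have "of_nat (length xs - descents xs) = (of_nat s - of_nat (descents xs) :: real fps)"
      using descents_le [of xs] len by (simp add: of_nat_diff)
    finally have *: "(\<Sum>ys\<leftarrow>insertions (Suc s) xs. (fps_X :: real fps) ^ descents ys) = 
      of_nat (Suc (descents xs)) * fps_X ^ descents xs
        + (of_nat s - of_nat (descents xs)) * fps_X ^ Suc (descents xs)" .
    have "fps_X * fps_deriv ((fps_X :: real fps) ^ d) = of_nat d * fps_X ^ d" for d
      by (rule fps_ext) (auto simp: fps_X_power_nth fps_mult_of_nat_nth)
    hence "fps_X * (1 - fps_X) * fps_deriv ((fps_X :: real fps) ^ descents xs)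
        = (1 - fps_X) * (of_nat (descents xs) * fps_X ^ descents xs)"
      by (simp add: mult_ac)
    thus "(\<Sum>ys\<leftarrow>insertions (Suc s) xs. (fps_X :: real fps) ^ descents ys) =
       (1 + of_nat s * fps_X) * fps_X ^ descents xs + fps_X * (1 - fps_X) * fps_deriv (fps_X ^ descents xs)"
      unfolding * by (simp add: algebra_simps)
  qed auto
  also have "\<dots> = (1 + of_nat s * fps_X) * P + fps_X * (1 - fps_X) * fps_deriv P"
    unfolding P_def fps_eulerian_poly by (simp add: sum.distrib sum_distrib_left fps_deriv_sum)
  finally show ?thesis .
qed

text \<open>The recurrence of the Eulerian polynomials is what \<open>f \<mapsto> (z f)'\<close> becomes on the numerators
  over \<open>(1 - z) ^ (s + 1)\<close>, and this operation turns the coefficients \<open>(n + 1) ^ s\<close> into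
  \<open>(n + 1) ^ (s + 1)\<close>.\<close>
lemma eulerian_poly_eq_power_series:
  "fps_of_poly (eulerian_poly s) = (1 - fps_X) ^ Suc s * power_series s"
proof (induction s)
  case 0
  have "(1 - fps_X) * power_series 0 = 1"
    by (simp add: fps_eq_iff power_series_def algebra_simps)
  thus ?case by (simp add: fps_eulerian_poly)
next
  case (Suc s)
  have Q: "power_series (Suc s) = fps_deriv (fps_X * power_series s)"
    by (simp add: fps_eq_iff power_series_def algebra_simps)
  have D: "fps_deriv ((1 - fps_X) ^ Suc s :: real fps) = - of_nat (Suc s) * (1 - fps_X) ^ s"
    by (subst fps_deriv_power) (simp add: fps_of_nat [symmetric])
  show ?case
    unfolding eulerian_poly_Suc Suc.IH Q fps_deriv_mult D
    by (simp add: algebra_simps)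
qed

lemma pcompose_neg_eulerian_poly:
  "fps_of_poly (pcompose (eulerian_poly s) [:0, -1:])
     = (1 + fps_X) ^ Suc s * Abs_fps (\<lambda>n. (- 1) ^ n * real (Suc n) ^ s)"
proof -
  have *: "fps_of_poly [:0, -1 :: real:] = - fps_X" by (simp add: fps_of_poly_pCons)
  have "fps_of_poly (pcompose (eulerian_poly s) [:0, -1:]) = ((1 - fps_X) ^ Suc s * power_series s) oo (- fps_X)"
    by (subst fps_of_poly_pcompose) (simp_all only: * eulerian_poly_eq_power_series, simp_all)
  also have "\<dots> = (1 + fps_X) ^ Suc s * (power_series s oo (- fps_X))"
    by (simp add: fps_compose_mult_distrib fps_compose_sub_distrib del: power_Suc flip: fps_compose_power)
  finally show ?thesis by (simp add: fps_compose_uminus' power_series_def)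
qed

section \<open>Abel sums of alternating powers\<close>

text \<open>The Abel sum of \<open>1 ^ s - 2 ^ s + 3 ^ s - \<dots>\<close>: the limit at \<open>z = 1\<close> of the rational function
  with power series \<open>\<Sum> (- 1) ^ n (n + 1) ^ s z ^ n\<close>, by \<open>pcompose_neg_eulerian_poly\<close>.\<close>
definition abel_eta :: "nat \<Rightarrow> real" where
  "abel_eta s = poly (eulerian_poly s) (- 1) / 2 ^ Suc s"

lemma fps_of_poly_of_nat: "fps_of_poly (of_nat n) = of_nat n"
  by (simp only: of_nat_poly fps_of_poly_const fps_of_nat)

text \<open>With \<open>G s = \<Sum> (- 1) ^ n (n + 1) ^ s z ^ n\<close>, shifting the index and expanding
  \<open>(n + 2) ^ s\<close> in powers of \<open>n + 1\<close> gives \<open>G s + z \<Sum>\<^sub>j (s choose j) G (s - j) = 1\<close>. Multiplied by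
  \<open>(1 + z) ^ (s + 1)\<close> this is an identity of polynomials, where \<open>z = 1\<close> may be substituted even though the
  series diverge there. The term \<open>j = 0\<close> is the second copy of the sum on the left.\<close>
lemma abel_eta_recurrence: "2 * abel_eta s = 1 - (\<Sum>j=1..s. real (s choose j) * abel_eta (s - j))"
proof -
  define G where "G = (\<lambda>s. Abs_fps (\<lambda>n. (- 1) ^ n * real (Suc n) ^ s))"
  define R where "R = (\<lambda>s. pcompose (eulerian_poly s) [:0, -1:])"
  have R: "fps_of_poly (R s) = (1 + fps_X) ^ Suc s * G s" for s
    unfolding R_def G_def by (rule pcompose_neg_eulerian_poly)
  have G: "G s + fps_X * (\<Sum>j\<le>s. of_nat (s choose j) * G (s - j)) = 1"
  proof (rule fps_ext)
    fix n
    have "(\<Sum>j\<le>s. real (s choose j) * real (Suc n) ^ (s - j)) = real (Suc (Suc n)) ^ s" for n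
      using binomial_ring [of 1 "real (Suc n)" s] by (simp add: add_ac)
    hence "(\<Sum>j\<le>s. real (s choose j) * ((- 1) ^ n * real (Suc n) ^ (s - j))) = (- 1) ^ n * real (Suc (Suc n)) ^ s" for n
      by (simp only: sum_distrib_left [symmetric] mult.left_commute [of "real _" "(- 1) ^ n"])
    thus "(G s + fps_X * (\<Sum>j\<le>s. of_nat (s choose j) * G (s - j))) $ n = 1 $ n"
      by (cases n) (simp_all add: G_def fps_sum_nth fps_mult_of_nat_nth)
  qed
  have "fps_of_poly (R s + [:0, 1:] * (\<Sum>j\<le>s. of_nat (s choose j) * [:1, 1:] ^ j * R (s - j)))
     = (1 + fps_X) ^ Suc s * G s + fps_X * (\<Sum>j\<le>s. of_nat (s choose j) * ((1 + fps_X) ^ j * (1 + fps_X) ^ Suc (s - j)) * G (s - j))"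
    by (simp add: fps_of_poly_add fps_of_poly_mult fps_of_poly_sum fps_of_poly_power R
        fps_of_poly_linear' fps_of_poly_pCons mult_ac fps_of_poly_of_nat del: power_Suc)
  also have "\<dots> = (1 + fps_X) ^ Suc s * (G s + fps_X * (\<Sum>j\<le>s. of_nat (s choose j) * G (s - j)))"
    by (simp add: algebra_simps sum_distrib_left flip: power_add)
  also have "\<dots> = fps_of_poly ([:1, 1:] ^ Suc s)"
    unfolding G by (simp add: fps_of_poly_power fps_of_poly_linear' del: power_Suc)
  finally have "R s + [:0, 1:] * (\<Sum>j\<le>s. of_nat (s choose j) * [:1, 1:] ^ j * R (s - j)) = [:1, 1:] ^ Suc s"
    by (simp only: fps_of_poly_eq_iff)
  from arg_cong [OF this, of "\<lambda>p. poly p 1"]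
  have "poly (eulerian_poly s) (- 1) + (\<Sum>j\<le>s. real (s choose j) * 2 ^ j * poly (eulerian_poly (s - j)) (- 1)) = 2 ^ Suc s"
    by (simp add: R_def poly_pcompose poly_sum poly_power del: power_Suc)
  also have "(\<Sum>j\<le>s. real (s choose j) * 2 ^ j * poly (eulerian_poly (s - j)) (- 1)) =
      2 ^ Suc s * (\<Sum>j\<le>s. real (s choose j) * abel_eta (s - j))"
    unfolding sum_distrib_left abel_eta_def
    by (rule sum.cong) (auto simp: field_simps power_diff)
  finally have "abel_eta s + (\<Sum>j\<le>s. real (s choose j) * abel_eta (s - j)) = 1"
    by (simp add: abel_eta_def field_simps)
  moreover have "{..s} = insert 0 {1..s}" by auto
  ultimately show ?thesis by simp
qed

section \<open>From Eulerian numbers to power series\<close>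

lemma descents_map_upt:
  "descents (map p [a..<b]) = card {i. a \<le> i \<and> Suc i < b \<and> p i > p (Suc i)}"
proof (induction "b - a" arbitrary: a)
  case 0
  hence "{i. a \<le> i \<and> Suc i < b \<and> p i > p (Suc i)} = {}" by auto
  thus ?case using 0 by (simp only:) simp
next
  case (Suc n)
  define D where "D = (\<lambda>a. {i. a \<le> i \<and> Suc i < b \<and> p i > p (Suc i)})"
  have ab: "[a..<b] = a # [Suc a..<b]" using Suc by (simp add: upt_conv_Cons)
  show ?case
  proof (cases "Suc a < b")
    case False
    hence "D a = {}" by (auto simp: D_def)
    thus ?thesis using False ab unfolding D_def by (simp only:) simp
  next
    case True
    have "[Suc a..<b] = Suc a # [Suc (Suc a)..<b]" using True by (simp add: upt_conv_Cons)
    hence "descents (map p [a..<b]) = of_bool (p a > p (Suc a)) + descents (map p [Suc a..<b])"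
      using ab by simp
    also have "descents (map p [Suc a..<b]) = card (D (Suc a))"
      unfolding D_def by (rule Suc) (use Suc in simp)
    also have "of_bool (p a > p (Suc a)) + card (D (Suc a)) = card (D a)"
    proof (cases "p a > p (Suc a)")
      case p: True
      have "D a = insert a (D (Suc a))" using True p by (auto simp: D_def Suc_le_eq le_less)
      moreover have "finite (D (Suc a))" by (rule finite_subset [of _ "{..b}"]) (auto simp: D_def)
      moreover have "a \<notin> D (Suc a)" by (simp add: D_def)
      ultimately show ?thesis using p by simp
    next
      case False
      hence "D a = D (Suc a)" by (auto simp: D_def) (metis not_less_eq_eq le_antisym)
      thus ?thesis using False by simp
    qed
    finally show ?thesis unfolding D_def .
  qed
qed

lemma bij_betw_permutes_permutations_of_set:
  "bij_betw (\<lambda>p. map p [a..<b]) {p. p permutes {a..<b}} (permutations_of_set {a..<b :: nat})"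
proof (rule bij_betwI')
  fix p q assume pq: "p \<in> {p. p permutes {a..<b}}" "q \<in> {p. p permutes {a..<b}}"
  show "map p [a..<b] = map q [a..<b] \<longleftrightarrow> p = q"
  proof
    assume "map p [a..<b] = map q [a..<b]"
    hence "p i = q i" if "i \<in> {a..<b}" for i using that by simp
    moreover have "p i = q i" if "i \<notin> {a..<b}" for i
      using pq that by (simp add: permutes_not_in)
    ultimately show "p = q" by blast
  qed simp
next
  fix p assume "p \<in> {p. p permutes {a..<b}}"
  thus "map p [a..<b] \<in> permutations_of_set {a..<b}"
    by (auto simp: permutations_of_set_def distinct_map permutes_image intro: permutes_inj_on)
next
  fix xs assume xs: "xs \<in> permutations_of_set {a..<b}"
  have len: "length xs = b - a" using length_finite_permutations_of_set [OF xs] by simp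
  define p where "p = (\<lambda>i. if i \<in> {a..<b} then xs ! (i - a) else i)"
  have map: "map p [a..<b] = xs"
    by (rule nth_equalityI) (auto simp: len p_def)
  hence "distinct (map p [a..<b])" "set (map p [a..<b]) = {a..<b}"
    using xs by (auto simp: permutations_of_set_def simp del: set_map)
  hence "bij_betw p {a..<b} {a..<b}"
    by (auto simp: bij_betw_def distinct_map)
  hence "p permutes {a..<b}" by (rule bij_imp_permutes) (auto simp: p_def)
  with map show "\<exists>p\<in>{p. p permutes {a..<b}}. xs = map p [a..<b]" by auto
qed

text \<open>The bridge between the Eulerian numbers, which count permutations as functions, and the
  sums over lists: a permutation has fewer than \<open>s\<close> descents because \<open>s \<ge> 1\<close>, hence the columns
  \<open>1..s\<close> exhaust all of them.\<close>
lemma sum_eulerian: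
  fixes f :: "nat \<Rightarrow> 'a :: comm_semiring_1"
  assumes "s \<ge> 1"
  shows "(\<Sum>k=1..s. of_nat (eulerian s k) * f (k - 1)) = (\<Sum>xs\<in>permutations_of_set {1..s}. f (descents xs))"
proof -
  define d where "d = (\<lambda>p :: nat \<Rightarrow> nat. card {i \<in> {1..<s}. p i > p (Suc i)} :: nat)"
  have d: "d p = descents (map p [1..<Suc s])" for p :: "nat \<Rightarrow> nat"
    unfolding d_def descents_map_upt by (rule arg_cong [of _ _ card]) auto
  have range: "d p \<in> {0..<s}" for p
  proof -
    have "d p \<le> card {1..<s}" unfolding d_def by (rule card_mono) auto
    thus ?thesis using assms by simp
  qed
  have "(\<Sum>k=1..s. of_nat (eulerian s k) * f (k - 1))
      = (\<Sum>k\<in>{0..<s}. of_nat (eulerian s (Suc k)) * f k)"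
    by (rule sum.reindex_bij_witness [of _ Suc "\<lambda>k. k - 1"]) auto
  also have "\<dots> = (\<Sum>k\<in>{0..<s}. \<Sum>p | p \<in> {p. p permutes {1..s}} \<and> d p = k. f (d p))"
    by (rule sum.cong) (simp_all add: eulerian_def d_def)
  also have "\<dots> = (\<Sum>p | p permutes {1..s}. f (d p))"
    by (rule sum.group) (use range in \<open>auto simp: finite_permutations\<close>)
  also have "\<dots> = (\<Sum>p | p permutes {1..<Suc s}. f (descents (map p [1..<Suc s])))"
    by (simp only: d atLeastLessThanSuc_atLeastAtMost)
  also have "\<dots> = (\<Sum>xs\<in>permutations_of_set {1..<Suc s}. f (descents xs))"
    by (rule sum.reindex_bij_betw [OF bij_betw_permutes_permutations_of_set])
  finally show ?thesis by (simp only: atLeastLessThanSuc_atLeastAtMost)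
qed

lemma Upsilon_eq_eulerian_poly:
  assumes "s \<ge> 1"
  shows "Upsilon s = eulerian_poly s"
proof -
  have "Upsilon s = (\<Sum>k=1..s. of_nat (eulerian s k) * monom 1 (k - 1))"
    unfolding Upsilon_def by (simp add: of_nat_poly smult_monom)
  also have "\<dots> = eulerian_poly s"
    unfolding sum_eulerian [OF assms] eulerian_poly_def ..
  finally show ?thesis .
qed

lemma pcompose_monom_monom:
  fixes a b :: "'a :: comm_ring_1"
  shows "pcompose (monom a m) (monom b n) = monom (a * b ^ m) (n * m)"
  by (induction m) (simp_all add: monom_0 monom_Suc [of a] pcompose_pCons mult_monom mult_ac)

lemma xi_eq_pcompose_Upsilon: "xi s = pcompose (Upsilon s) [:0, -1:]"
proof -
  have "[:0, -1:] = monom (-1 :: real) 1" by (simp add: monom_altdef)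
  thus ?thesis unfolding xi_def Upsilon_def pcompose_sum
    by (simp add: pcompose_monom_monom)
qed

lemma Lambda_eq_pcompose_Upsilon: "Lambda s = monom 1 1 * pcompose (Upsilon s) (monom 1 2)"
  unfolding Lambda_def Upsilon_def pcompose_sum sum_distrib_left
proof (rule sum.cong)
  fix k assume "k \<in> {1..s}"
  hence "k \<ge> 1" by simp
  hence "2 * k - 1 = 1 + 2 * (k - 1)" by arith
  thus "monom (of_nat (eulerian s k)) (2 * k - 1) =
     monom 1 1 * pcompose (monom (real (eulerian s k)) (k - 1)) (monom 1 2)"
    by (simp add: pcompose_monom_monom mult_monom)
qed simp

lemma Upsilon_eq_power_series:
  "s \<ge> 1 \<Longrightarrow> fps_of_poly (Upsilon s) = (1 - fps_X) ^ (s + 1) * power_series s"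
  by (simp only: Upsilon_eq_eulerian_poly eulerian_poly_eq_power_series Suc_eq_plus1)

lemma xi_eq_power_series:
  "s \<ge> 1 \<Longrightarrow> fps_of_poly (xi s) = (1 + fps_X) ^ (s + 1) * Abs_fps (\<lambda>n. (- 1) ^ n * real (Suc n) ^ s)"
  by (simp only: xi_eq_pcompose_Upsilon Upsilon_eq_eulerian_poly pcompose_neg_eulerian_poly Suc_eq_plus1)

lemma Lambda_eq_power_series:
  assumes "s \<ge> 1"
  shows "fps_of_poly (Lambda s)
           = (1 - fps_X) ^ (s + 1) * (1 + fps_X) ^ (s + 1) * (fps_X * (power_series s oo fps_X ^ 2))"
proof -
  have "fps_of_poly (Lambda s) = fps_X * (fps_of_poly (Upsilon s) oo fps_X ^ 2)"
    by (simp add: Lambda_eq_pcompose_Upsilon fps_of_poly_mult fps_of_poly_pcompose fps_of_poly_monom)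
  also have "fps_of_poly (Upsilon s) oo fps_X ^ 2 = (1 - fps_X ^ 2) ^ (s + 1) * (power_series s oo fps_X ^ 2)"
    unfolding Upsilon_eq_power_series [OF assms]
    by (simp add: fps_compose_mult_distrib fps_compose_sub_distrib del: power_Suc flip: fps_compose_power)
  also have "1 - fps_X ^ 2 = (1 - fps_X) * (1 + fps_X :: real fps)"
    by (simp add: algebra_simps power2_eq_square)
  finally show ?thesis by (simp add: power_mult_distrib mult_ac)
qed

text \<open>The factor \<open>2 ^ (s + 1)\<close> splits as \<open>2 * 2 ^ s\<close>: at the exponent \<open>2 m + 1\<close> the power
  \<open>2 ^ s\<close> turns \<open>(m + 1) ^ s\<close> into \<open>(2 m + 2) ^ s\<close>, the coefficient of the full series there, and the
  factor \<open>2\<close> flips its sign.\<close>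
lemma power_series_signs:
  "power_series s - 2 ^ (s + 1) * (fps_X * (power_series s oo fps_X ^ 2))
     = Abs_fps (\<lambda>n. (- 1) ^ n * real (Suc n) ^ s)"
proof (rule fps_ext)
  fix n
  have two: "fps_nth (2 ^ (s + 1) * f) n = 2 ^ (s + 1) * fps_nth f n" for f :: "real fps"
    by (metis fps_const_power fps_mult_left_const_nth numeral_fps_const)
  show "(power_series s - 2 ^ (s + 1) * (fps_X * (power_series s oo fps_X ^ 2))) $ n
      = Abs_fps (\<lambda>n. (- 1) ^ n * real (Suc n) ^ s) $ n"
  proof (cases "even n")
    case True
    thus ?thesis unfolding fps_sub_nth two
      by (cases n) (auto simp: power_series_def fps_nth_compose_X_power)
  next
    case False
    then obtain m where n: "n = Suc (2 * m)" by (auto elim: oddE)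
    have "2 ^ s * real (Suc m) ^ s = real (Suc n) ^ s"
      unfolding n by (simp add: algebra_simps flip: power_mult_distrib)
    thus ?thesis unfolding fps_sub_nth two
      by (simp add: n power_series_def fps_nth_compose_X_power)
  qed
qed

lemma poly_xi_1: "s \<ge> 1 \<Longrightarrow> poly (xi s) 1 / 2 ^ (s + 1) = abel_eta s"
  by (simp add: xi_eq_pcompose_Upsilon Upsilon_eq_eulerian_poly poly_pcompose abel_eta_def)

section \<open>Dirichlet series and Taylor remainders\<close>

lemma gbinomial_Suc_mult:
  fixes a :: "'a :: field_char_0"
  shows "of_nat (Suc j) * (a gchoose Suc j) = (a - of_nat j) * (a gchoose j)"
proof -
  have "of_nat (Suc j) \<noteq> (0 :: 'a)" by (rule of_nat_neq_0)
  thus ?thesis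
    by (simp add: gbinomial_prod_rev field_simps del: of_nat_Suc)
qed

lemma holomorphic_on_gbinomial [holomorphic_intros]:
  assumes "f holomorphic_on A"
  shows "(\<lambda>w. f w gchoose k) holomorphic_on A"
  unfolding gbinomial_prod_rev by (intro holomorphic_intros assms) auto

text \<open>The terms of Dirichlet series, indexed from \<open>0\<close> to keep clear of the power of zero.\<close>
definition nat_power :: "complex \<Rightarrow> nat \<Rightarrow> complex" where
  "nat_power w n = of_nat (Suc n) powr (- w)"

text \<open>The error of the binomial expansion of \<open>(n + 2) powr - w\<close> in powers of \<open>n + 1\<close>, that is, of
  the Taylor polynomial of degree \<open>K\<close> at \<open>n + 1\<close> for a step of length \<open>1\<close>.\<close>
definition step_remainder :: "nat \<Rightarrow> complex \<Rightarrow> nat \<Rightarrow> complex" where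
  "step_remainder K w n =
     nat_power w (Suc n) - (\<Sum>j\<le>K. (- w gchoose j) * nat_power (w + of_nat j) n)"

lemma norm_nat_power: "norm (nat_power w n) = real (Suc n) powr (- Re w)"
  unfolding nat_power_def by (subst norm_powr_real_powr) auto

lemma holomorphic_nat_power [holomorphic_intros]:
  "f holomorphic_on A \<Longrightarrow> (\<lambda>w. nat_power (f w) n) holomorphic_on A"
  unfolding nat_power_def by (intro holomorphic_intros)

lemma holomorphic_step_remainder: "(\<lambda>w. step_remainder K w n) holomorphic_on A"
  unfolding step_remainder_def by (intro holomorphic_intros)

text \<open>The Taylor estimate on the segment from \<open>n + 1\<close> to \<open>n + 2\<close>. Every derivative taken lowers
  the exponent by one, so the error decays by \<open>K + 1\<close> powers of \<open>n\<close> faster than the terms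
  themselves; this is the whole gain in the domain of convergence.\<close>
lemma norm_step_remainder_le:
  assumes "- real (Suc K) \<le> Re w"
  shows "norm (step_remainder K w n)
           \<le> real (Suc K) * norm (- w gchoose Suc K) * real (Suc n) powr (- Re w - real (Suc K))"
proof -
  \<comment> \<open>\<open>f j\<close> is the derivative of order \<open>j\<close> of \<open>t \<mapsto> t powr - w\<close>.\<close>
  define f where "f = (\<lambda>j t. (- w gchoose j) * fact j * t powr (- w - of_nat j))"
  define a b :: complex where "a = of_real (real (Suc n))" and "b = of_real (real (Suc (Suc n)))"
  define S where "S = closed_segment a b"
  define B where "B = norm (- w gchoose Suc K) * fact (Suc K) * real (Suc n) powr (- Re w - real (Suc K))"
  have S: "\<exists>x. t = of_real x \<and> real (Suc n) \<le> x" if "t \<in> S" for t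
    using that unfolding S_def a_def b_def closed_segment_of_real 
    by (auto simp: closed_segment_eq_real_ivl split: if_splits)
  have "norm (f 0 b - (\<Sum>i\<le>K. f i a * (b - a) ^ i / fact i)) \<le> B * norm (b - a) ^ Suc K / fact K"
  proof (rule complex_Taylor)
    show "convex S" unfolding S_def by simp
    fix i t assume "t \<in> S"
    then obtain x where x: "t = of_real x" "real (Suc n) \<le> x" using S by blast
    hence t: "t \<notin> \<real>\<^sub>\<le>\<^sub>0" by (auto simp: complex_nonpos_Reals_iff)
    have "(f i has_field_derivative
       (- w gchoose i) * fact i * ((- w - of_nat i) * t powr (- w - of_nat i - 1))) (at t within S)"
      unfolding f_def
      by (rule DERIV_cmult, rule has_field_derivative_at_within, rule has_field_derivative_powr, rule t)
    also have "(- w gchoose i) * fact i * ((- w - of_nat i) * t powr (- w - of_nat i - 1))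
        = fact i * ((- w - of_nat i) * (- w gchoose i)) * t powr (- w - of_nat (Suc i))"
      by (simp add: algebra_simps)
    also have "\<dots> = f (Suc i) t"
      unfolding gbinomial_Suc_mult [symmetric] f_def by (simp add: algebra_simps)
    finally show "(f i has_field_derivative f (Suc i) t) (at t within S)" .
  next
    fix t assume "t \<in> S"
    then obtain x where x: "t = of_real x" "real (Suc n) \<le> x" using S by blast
    have "norm (t powr (- w - of_nat (Suc K))) = x powr (- Re w - real (Suc K))"
      using x by (subst norm_powr_real_powr) auto
    also have "\<dots> \<le> real (Suc n) powr (- Re w - real (Suc K))"
      using x assms by (intro powr_mono2') auto
    finally show "norm (f (Suc K) t) \<le> B"
      unfolding f_def B_def norm_mult norm_fact by (intro mult_left_mono) auto
  qed (auto simp: S_def)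
  also have "f 0 b - (\<Sum>i\<le>K. f i a * (b - a) ^ i / fact i) = step_remainder K w n"
    unfolding f_def a_def b_def step_remainder_def nat_power_def by (simp add: algebra_simps)
  also have "B * norm (b - a) ^ Suc K / fact K = 
    real (Suc K) * norm (- w gchoose Suc K) * real (Suc n) powr (- Re w - real (Suc K))"
    unfolding B_def a_def b_def by (simp add: field_simps)
  finally show ?thesis .
qed

lemma summable_Suc_powr: "s < -1 \<Longrightarrow> summable (\<lambda>n. real (Suc n) powr s)"
  by (subst summable_Suc_iff [of "\<lambda>n. real n powr s"]) (simp add: summable_real_powr_iff)

definition dirichlet_sum :: "(nat \<Rightarrow> complex) \<Rightarrow> complex \<Rightarrow> complex" where
  "dirichlet_sum e w = (\<Sum>n. e n * nat_power w n)"

definition remainder_sum :: "(nat \<Rightarrow> complex) \<Rightarrow> nat \<Rightarrow> complex \<Rightarrow> complex" where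
  "remainder_sum e K w = (\<Sum>n. e n * step_remainder K w n)"

lemma dirichlet_sum_sums:
  assumes "\<And>n. norm (e n) \<le> 1" and "Re w > 1"
  shows "(\<lambda>n. e n * nat_power w n) sums dirichlet_sum e w"
  unfolding dirichlet_sum_def
proof (rule summable_sums, rule summable_comparison_test')
  show "summable (\<lambda>n. real (Suc n) powr (- Re w))" by (rule summable_Suc_powr) (use assms in simp)
  show "norm (e n * nat_power w n) \<le> real (Suc n) powr (- Re w)" for n
    unfolding norm_mult norm_nat_power using assms(1) by (intro mult_left_le_one_le) auto
qed

text \<open>The majorant behind both the convergence and the holomorphy of the remainder series: on a
  disc that stays at distance \<open>d\<close> from the line \<open>Re w = - K\<close>, the terms are bounded by a constant
  multiple of \<open>(n + 1) powr (- 1 - d)\<close>.\<close>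
lemma remainder_uniform_bound:
  assumes "\<And>n. norm (e n) \<le> 1" and "Re w0 > - real K"
  obtains d M where "d > 0" "cball w0 d \<subseteq> {w. Re w > - real K}" "summable M"
    "\<And>n w. w \<in> cball w0 d \<Longrightarrow> norm (e n * step_remainder K w n) \<le> M n"
proof -
  define d where "d = (Re w0 + real K) / 2"
  have d: "d > 0" using assms by (simp add: d_def)
  have "continuous_on (cball w0 d) (\<lambda>w. - w gchoose Suc K)"
    by (intro holomorphic_on_imp_continuous_on holomorphic_intros)
  hence "compact ((\<lambda>w. - w gchoose Suc K) ` cball w0 d)"
    by (intro compact_continuous_image) auto
  then obtain C where C: "\<And>w. w \<in> cball w0 d \<Longrightarrow> norm (- w gchoose Suc K) \<le> C"
    by (metis compact_imp_bounded bounded_iff imageI)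
  have Re: "Re w \<ge> d - real K" if "w \<in> cball w0 d" for w
  proof -
    have "Re w0 - Re w \<le> d"
      using that complex_Re_le_cmod [of "w0 - w"] by (simp add: dist_norm)
    thus ?thesis unfolding d_def by (simp add: field_simps)
  qed
  show ?thesis
  proof (rule that)
    show "d > 0" by fact
    show "cball w0 d \<subseteq> {w. Re w > - real K}" using Re d by force
    show "summable (\<lambda>n. real (Suc K) * C * real (Suc n) powr (- 1 - d))"
      by (intro summable_mult summable_Suc_powr) (use d in simp)
    fix n w assume w: "w \<in> cball w0 d"
    have C0: "C \<ge> 0" using C [OF w] norm_ge_zero order_trans by blast
    have "norm (e n * step_remainder K w n) \<le> norm (step_remainder K w n)"
      unfolding norm_mult using assms(1) by (intro mult_left_le_one_le) auto
    also have "\<dots> \<le> real (Suc K) * norm (- w gchoose Suc K) * real (Suc n) powr (- Re w - real (Suc K))"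
      by (rule norm_step_remainder_le) (use Re [OF w] d in simp)
    also have "\<dots> \<le> real (Suc K) * C * real (Suc n) powr (- 1 - d)"
      using C [OF w] C0 Re [OF w] by (intro mult_mono powr_mono) auto
    finally show "norm (e n * step_remainder K w n) \<le> real (Suc K) * C * real (Suc n) powr (- 1 - d)" .
  qed
qed

lemma remainder_sum_sums:
  assumes "\<And>n. norm (e n) \<le> 1" and "Re w > - real K"
  shows "(\<lambda>n. e n * step_remainder K w n) sums remainder_sum e K w"
  unfolding remainder_sum_def
proof (rule summable_sums, rule remainder_uniform_bound [OF assms])
  fix d M assume d: "d > 0" and M: "summable M"
    "\<And>n u. u \<in> cball w d \<Longrightarrow> norm (e n * step_remainder K u n) \<le> M n"
  show "summable (\<lambda>n. e n * step_remainder K w n)"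
    by (rule summable_comparison_test' [OF M(1)], rule M(2)) (use d in simp)
qed

lemma holomorphic_remainder_sum:
  assumes "\<And>n. norm (e n) \<le> 1"
  shows "remainder_sum e K holomorphic_on {w. Re w > - real K}"
proof (rule holomorphic_uniform_sequence)
  show "open {w. Re w > - real K}" by (simp add: open_halfspace_Re_gt)
  show "(\<lambda>w. \<Sum>i<n. e i * step_remainder K w i) holomorphic_on {w. Re w > - real K}" for n
    by (intro holomorphic_intros holomorphic_step_remainder)
  fix w0 assume "w0 \<in> {w. Re w > - real K}"
  hence w0: "Re w0 > - real K" by simp
  obtain d M where
    dM: "d > 0" "cball w0 d \<subseteq> {w. Re w > - real K}" "summable M"
    "\<And>n w. w \<in> cball w0 d \<Longrightarrow> norm (e n * step_remainder K w n) \<le> M n"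
    by (rule remainder_uniform_bound [OF assms w0], rule that)
  have "uniform_limit (cball w0 d) (\<lambda>n w. \<Sum>i<n. e i * step_remainder K w i) (remainder_sum e K) sequentially"
    unfolding remainder_sum_def [abs_def] by (rule Weierstrass_m_test) (use dM in auto)
  thus "\<exists>d>0. cball w0 d \<subseteq> {w. Re w > - real K} \<and>
     uniform_limit (cball w0 d) (\<lambda>n w. \<Sum>i<n. e i * step_remainder K w i) (remainder_sum e K) sequentially"
    using dM by blast
qed

text \<open>The relation that carries the continuation. It is stated for differences, which removes the
  term \<open>j = 0\<close>: what is left involves the Dirichlet series only at \<open>w + 1, w + 2, \<dots>\<close>, so \<open>Re w > 0\<close>
  is enough for convergence. For alternating signs \<open>e\<close> the left-hand side yields \<open>1 - 2 \<eta>(w)\<close>, for constant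
  \<open>e\<close> it telescopes.\<close>
lemma nat_power_difference_sums:
  assumes e: "\<And>n. norm (e n) \<le> 1" and w: "Re w > 0"
  shows "(\<lambda>n. e n * (nat_power w (Suc n) - nat_power w n)) sums
           ((\<Sum>j=1..K. (- w gchoose j) * dirichlet_sum e (w + of_nat j)) + remainder_sum e K w)"
proof -
  have "(\<lambda>n. (\<Sum>j=1..K. (- w gchoose j) * (e n * nat_power (w + of_nat j) n)) + e n * step_remainder K w n) sums
         ((\<Sum>j=1..K. (- w gchoose j) * dirichlet_sum e (w + of_nat j)) + remainder_sum e K w)"
    using w by (intro sums_add sums_sum sums_mult dirichlet_sum_sums remainder_sum_sums e) auto
  also have "(\<lambda>n. (\<Sum>j=1..K. (- w gchoose j) * (e n * nat_power (w + of_nat j) n)) + e n * step_remainder K w n)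
     = (\<lambda>n. e n * (nat_power w (Suc n) - nat_power w n))"
  proof
    fix n
    have "{..K} = insert 0 {1..K}" by auto
    thus "(\<Sum>j=1..K. (- w gchoose j) * (e n * nat_power (w + of_nat j) n)) + e n * step_remainder K w n
       = e n * (nat_power w (Suc n) - nat_power w n)"
      unfolding step_remainder_def by (simp add: algebra_simps sum_distrib_left)
  qed
  finally show ?thesis .
qed

text \<open>If \<open>f0 w\<close> is expressed by a function that is holomorphic further to the left and by the values of
  \<open>f0\<close> at \<open>w + 1, w + 2, \<dots>\<close>, then knowing \<open>f0\<close> for \<open>Re w > - K\<close> determines it for
  \<open>Re w > - (K + 1)\<close>. The extensions to these half-planes agree by the identity theorem and glue to an
  entire function, for which the relation persists.\<close>
lemma entire_extension:
  fixes f0 :: "complex \<Rightarrow> complex" and A p :: "nat \<Rightarrow> complex \<Rightarrow> complex"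
  assumes A: "\<And>K. A K holomorphic_on {w. Re w > - real K}"
    and p: "\<And>i. p i holomorphic_on UNIV"
    and rec: "\<And>K w. Re w > 1 \<Longrightarrow> f0 w = A K w + (\<Sum>i=1..K. p i w * f0 (w + of_nat i))"
  obtains f where "f holomorphic_on UNIV" "\<And>w. Re w > 1 \<Longrightarrow> f w = f0 w"
    "\<And>K w. Re w > - real K \<Longrightarrow> f w = A K w + (\<Sum>i=1..K. p i w * f (w + of_nat i))"
proof -
  define H where "H = (\<lambda>K. {w :: complex. Re w > - real K})"
  have H: "open (H K)" "connected (H K)" for K
    unfolding H_def
    by (auto simp: open_halfspace_Re_gt intro!: convex_connected convex_halfspace_Re_gt)
  have opn1: "open {w. Re w > 1}" by (rule open_halfspace_Re_gt)
  have "2 \<in> {w. Re w > 1}" by simp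
  hence ne1: "{w. Re w > 1} \<noteq> {}" by blast
  have "\<exists>g. g holomorphic_on H K \<and> (\<forall>w. Re w > 1 \<longrightarrow> g w = f0 w)" for K
  proof (induction K)
    case 0
    have "A 0 holomorphic_on H 0" using A [of 0] unfolding H_def .
    moreover have "A 0 w = f0 w" if "Re w > 1" for w using rec [OF that, of 0] by simp
    ultimately show ?case by blast
  next
    case (Suc K)
    then obtain g where g: "g holomorphic_on H K" "\<And>w. Re w > 1 \<Longrightarrow> g w = f0 w" by blast
    define g' where "g' = (\<lambda>w. A (Suc K) w + (\<Sum>i=1..Suc K. p i w * g (w + of_nat i)))"
    have "(\<lambda>w. g (w + of_nat i)) holomorphic_on H (Suc K)" if "i \<in> {1..Suc K}" for i
    proof -
      have "(g \<circ> (\<lambda>w. w + of_nat i)) holomorphic_on H (Suc K)"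
        by (rule holomorphic_on_compose_gen [OF _ g(1)])
           (use that in \<open>auto simp: H_def intro!: holomorphic_intros\<close>)
      thus ?thesis by (simp add: o_def)
    qed
    moreover have "A (Suc K) holomorphic_on H (Suc K)" using A [of "Suc K"] unfolding H_def .
    ultimately have "g' holomorphic_on H (Suc K)"
      unfolding g'_def using p
      by (intro holomorphic_intros) (auto intro: holomorphic_on_subset)
    moreover have "g' w = f0 w" if "Re w > 1" for w
    proof -
      have "g (w + of_nat i) = f0 (w + of_nat i)" for i using that by (intro g) auto
      thus ?thesis unfolding g'_def using rec [OF that, of "Suc K"] by simp
    qed
    ultimately show ?case by blast
  qed
  then obtain g where g: "\<And>K. g K holomorphic_on H K" "\<And>K w. Re w > 1 \<Longrightarrow> g K w = f0 w" by metis
  have mono: "H K \<subseteq> H L" if "K \<le> L" for K L using that by (auto simp: H_def)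
  have agree: "g K w = g L w" if "K \<le> L" "w \<in> H K" for K L w
    by (rule analytic_continuation_open [OF opn1 H(1) [of K] ne1 H(2)])
       (use that g mono [OF that(1)] in \<open>auto simp: H_def intro: holomorphic_on_subset\<close>)
  \<comment> \<open>Any half-plane that contains \<open>w\<close> would do; this index gives one of them.\<close>
  define f where "f = (\<lambda>w. g (nat \<lceil>1 - Re w\<rceil>) w)"
  have f: "f w = g K w" if "w \<in> H K" for K w
  proof -
    have "w \<in> H (nat \<lceil>1 - Re w\<rceil>)" unfolding H_def by simp linarith
    thus ?thesis unfolding f_def using agree that by (metis nle_le)
  qed
  have "f holomorphic_on H K" for K
    using g(1) [of K] by (rule holomorphic_transform) (simp add: f)
  hence "f holomorphic_on (\<Union>K. H K)" by (intro holomorphic_on_UN_open H(1))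
  moreover have "(\<Union>K. H K) = UNIV"
  proof -
    have "w \<in> H (nat \<lceil>1 - Re w\<rceil>)" for w unfolding H_def by simp linarith
    thus ?thesis by blast
  qed
  ultimately have hol: "f holomorphic_on UNIV" by simp
  have f0: "f w = f0 w" if "Re w > 1" for w using f [of w 0] g(2) that by (simp add: H_def)
  have "f w = A K w + (\<Sum>i=1..K. p i w * f (w + of_nat i))" if "Re w > - real K" for K w
  proof (rule analytic_continuation_open [OF opn1 H(1) [of K] ne1 H(2),
        where g = "\<lambda>w. A K w + (\<Sum>i=1..K. p i w * f (w + of_nat i))"])
    have "(\<lambda>w. f (w + of_nat i)) holomorphic_on H K" for i
    proof -
      have "(f \<circ> (\<lambda>w. w + of_nat i)) holomorphic_on H K"
        by (rule holomorphic_on_compose_gen [OF _ hol]) (auto intro!: holomorphic_intros)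
      thus ?thesis by (simp add: o_def)
    qed
    moreover have "A K holomorphic_on H K" using A [of K] unfolding H_def .
    ultimately show "(\<lambda>w. A K w + (\<Sum>i=1..K. p i w * f (w + of_nat i))) holomorphic_on H K"
      using p by (intro holomorphic_intros) (auto intro: holomorphic_on_subset)
    show "f z = A K z + (\<Sum>i=1..K. p i z * f (z + of_nat i))" if "z \<in> {w. Re w > 1}" for z
    proof -
      have "f (z + of_nat i) = f0 (z + of_nat i)" for i using that by (intro f0) auto
      thus ?thesis using that rec [of z K] by (simp add: f0)
    qed
    show "f holomorphic_on H K" using hol by (rule holomorphic_on_subset) simp
    show "{w. Re w > 1} \<subseteq> H K" by (auto simp: H_def)
    show "w \<in> H K" using that by (simp add: H_def)
  qed
  with hol f0 show ?thesis by (rule that)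
qed

section \<open>The eta and zeta functions\<close>

lemma nat_power_neg_of_nat: "nat_power (- of_nat k) n = of_nat (Suc n) ^ k"
  unfolding nat_power_def by (simp add: powr_nat' del: of_nat_Suc)

text \<open>At a nonpositive integer the Taylor polynomial is the finite binomial expansion of
  \<open>(n + 2) ^ s\<close>, which is exact.\<close>
lemma step_remainder_neg_of_nat:
  assumes "s \<le> K"
  shows "step_remainder K (- of_nat s) n = 0"
proof -
  have "(\<Sum>j\<le>K. (of_nat s gchoose j) * nat_power (- of_nat s + of_nat j) n)
      = (\<Sum>j\<le>s. of_nat (s choose j) * of_nat (Suc n) ^ (s - j) :: complex)"
  proof (rule sum.mono_neutral_cong_right)
    show "\<forall>j\<in>{..K} - {..s}. (of_nat s gchoose j) * nat_power (- of_nat s + of_nat j) n = 0"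
      by (auto simp flip: binomial_gbinomial)
    fix j assume "j \<in> {..s}"
    hence "- of_nat s + of_nat j = (- of_nat (s - j) :: complex)" by (simp add: of_nat_diff)
    thus "(of_nat s gchoose j) * nat_power (- of_nat s + of_nat j) n
        = of_nat (s choose j) * of_nat (Suc n) ^ (s - j)"
      by (simp only: nat_power_neg_of_nat binomial_gbinomial)
  qed (use assms in auto)
  also have "\<dots> = (1 + of_nat (Suc n)) ^ s"
    by (simp only: binomial_ring power_one mult_1_right)
  finally show ?thesis
    by (simp add: step_remainder_def nat_power_neg_of_nat)
qed

text \<open>The values at nonpositive integers come by induction from the relation in \<open>entire_extension\<close>,
  taken with \<open>K = s + 1\<close> so that \<open>- s\<close> lies inside the half-plane of validity: there it becomes
  \<open>abel_eta_recurrence\<close>.\<close>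
lemma eta_extension:
  obtains eta where "eta holomorphic_on UNIV"
    and "\<And>w. Re w > 1 \<Longrightarrow> (\<lambda>n. (- 1) ^ n * nat_power w n) sums eta w"
    and "\<And>s. eta (- of_nat s) = of_real (abel_eta s)"
proof -
  define e where "e = (\<lambda>n. (- 1) ^ n :: complex)"
  have e: "norm (e n) \<le> 1" for n by (simp add: e_def norm_power)
  define A where "A = (\<lambda>K w. (1 - remainder_sum e K w) / 2)"
  define p where "p = (\<lambda>i w. - ((- w gchoose i) / 2) :: complex)"
  have A: "A K holomorphic_on {w. Re w > - real K}" for K
    unfolding A_def by (intro holomorphic_intros holomorphic_remainder_sum e) auto
  have p: "p i holomorphic_on UNIV" for i
    unfolding p_def by (intro holomorphic_intros) auto
  have rec: "dirichlet_sum e w = A K w + (\<Sum>i=1..K. p i w * dirichlet_sum e (w + of_nat i))"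
    if w: "Re w > 1" for K w
  proof -
    have S: "(\<lambda>n. e n * nat_power w n) sums dirichlet_sum e w"
      using e w by (rule dirichlet_sum_sums)
    hence "(\<lambda>n. e (Suc n) * nat_power w (Suc n)) sums (dirichlet_sum e w - e 0 * nat_power w 0)"
      by (subst sums_Suc_iff) simp
    hence "(\<lambda>n. - (e (Suc n) * nat_power w (Suc n)) - e n * nat_power w n)
        sums (- (dirichlet_sum e w - e 0 * nat_power w 0) - dirichlet_sum e w)"
      by (intro sums_diff sums_minus S)
    also have "(\<lambda>n. - (e (Suc n) * nat_power w (Suc n)) - e n * nat_power w n)
        = (\<lambda>n. e n * (nat_power w (Suc n) - nat_power w n))"
      by (simp add: e_def algebra_simps)
    finally have "(\<lambda>n. e n * (nat_power w (Suc n) - nat_power w n)) sums (1 - 2 * dirichlet_sum e w)"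
      by (simp add: e_def nat_power_def)
    moreover have "(\<lambda>n. e n * (nat_power w (Suc n) - nat_power w n)) sums
       ((\<Sum>j=1..K. (- w gchoose j) * dirichlet_sum e (w + of_nat j)) + remainder_sum e K w)"
      by (rule nat_power_difference_sums) (use e w in auto)
    ultimately have "1 - 2 * dirichlet_sum e w
        = (\<Sum>j=1..K. (- w gchoose j) * dirichlet_sum e (w + of_nat j)) + remainder_sum e K w"
      by (rule sums_unique2)
    hence "2 * dirichlet_sum e w = 1 - remainder_sum e K w
        - (\<Sum>j=1..K. (- w gchoose j) * dirichlet_sum e (w + of_nat j))"
      by algebra
    hence "dirichlet_sum e w = (1 - remainder_sum e K w
        - (\<Sum>j=1..K. (- w gchoose j) * dirichlet_sum e (w + of_nat j))) / 2"
      by (metis nonzero_mult_div_cancel_left zero_neq_numeral)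
    hence "dirichlet_sum e w = A K w
        - (\<Sum>j=1..K. (- w gchoose j) * dirichlet_sum e (w + of_nat j)) / 2"
      by (simp only: A_def diff_divide_distrib)
    thus ?thesis by (simp add: p_def sum_negf sum_divide_distrib)
  qed
  from entire_extension [of A p "dirichlet_sum e", OF A p rec] obtain eta where
    eta: "eta holomorphic_on UNIV" "\<And>w. Re w > 1 \<Longrightarrow> eta w = dirichlet_sum e w"
      "\<And>K w. Re w > - real K \<Longrightarrow> eta w = A K w + (\<Sum>i=1..K. p i w * eta (w + of_nat i))"
    by blast
  have "eta (- of_nat s) = of_real (abel_eta s)" for s
  proof (induction s rule: less_induct)
    case (less s)
    have "A (Suc s) (- of_nat s) = 1 / 2"
      by (simp add: A_def remainder_sum_def step_remainder_neg_of_nat)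
    moreover have "eta (- of_nat s) = A (Suc s) (- of_nat s)
        + (\<Sum>i=1..Suc s. p i (- of_nat s) * eta (- of_nat s + of_nat i))"
      by (rule eta(3)) simp
    moreover have "(\<Sum>i=1..Suc s. p i (- of_nat s) * eta (- of_nat s + of_nat i))
        = (\<Sum>i=1..s. - of_real (real (s choose i) * abel_eta (s - i)) / 2)"
    proof (rule sum.mono_neutral_cong_right)
      show "\<forall>i\<in>{1..Suc s} - {1..s}. p i (- of_nat s) * eta (- of_nat s + of_nat i) = 0"
        by (auto simp: p_def simp flip: binomial_gbinomial)
      fix i assume i: "i \<in> {1..s}"
      hence "- of_nat s + of_nat i = (- of_nat (s - i) :: complex)" by (simp add: of_nat_diff)
      moreover have "eta (- of_nat (s - i)) = of_real (abel_eta (s - i))"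
        using i by (intro less.IH) auto
      moreover have "p i (- of_nat s) = - (of_nat (s choose i) / 2)"
        by (simp add: p_def binomial_gbinomial)
      ultimately show "p i (- of_nat s) * eta (- of_nat s + of_nat i)
          = - of_real (real (s choose i) * abel_eta (s - i)) / 2"
        by simp
    qed auto
    ultimately have "eta (- of_nat s)
        = 1 / 2 + (\<Sum>i=1..s. - of_real (real (s choose i) * abel_eta (s - i)) / 2)"
      by simp
    also have "\<dots> = of_real ((1 - (\<Sum>i=1..s. real (s choose i) * abel_eta (s - i))) / 2)"
      by (simp add: sum_negf diff_divide_distrib flip: sum_divide_distrib)
    also have "(1 - (\<Sum>i=1..s. real (s choose i) * abel_eta (s - i))) / 2 = abel_eta s"
      using abel_eta_recurrence [of s] by simp
    finally show ?case .
  qed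
  moreover have "(\<lambda>n. (- 1) ^ n * nat_power w n) sums eta w" if "Re w > 1" for w
    using dirichlet_sum_sums [of e w, OF e that] eta(2) [OF that] by (simp add: e_def)
  ultimately show ?thesis using eta(1) that by blast
qed

text \<open>The relation is used at \<open>w - 1\<close>, where its term \<open>j = 1\<close> is \<open>(1 - w) \<zeta>(w)\<close> and the differences
  telescope to \<open>- 1\<close>. Multiplying by \<open>w - 1\<close> removes the pole throughout the continuation: the
  coefficient of \<open>\<zeta>(w + i)\<close> contains the factor \<open>w + i - 1\<close>, hence the relation can be written in terms of
  \<open>(w + i - 1) \<zeta>(w + i)\<close> without denominators.\<close>
lemma zeta_extension:
  obtains F where "F holomorphic_on UNIV"
    and "\<And>w. Re w > 1 \<Longrightarrow> F w = (w - 1) * dirichlet_sum (\<lambda>_. 1) w"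
proof -
  define D where "D = dirichlet_sum (\<lambda>_. 1)"
  define A where "A = (\<lambda>K w. 1 + remainder_sum (\<lambda>_. 1) (Suc K) (w - 1))"
  define p where "p = (\<lambda>i w. - ((1 - w gchoose i) / of_nat (Suc i)) :: complex)"
  have A: "A K holomorphic_on {w. Re w > - real K}" for K
  proof -
    have "(remainder_sum (\<lambda>_. 1) (Suc K) \<circ> (\<lambda>w. w - 1)) holomorphic_on {w. Re w > - real K}"
      by (rule holomorphic_on_compose_gen [OF _ holomorphic_remainder_sum])
         (auto intro!: holomorphic_intros)
    thus ?thesis unfolding A_def by (auto simp: o_def intro!: holomorphic_intros)
  qed
  have p: "p i holomorphic_on UNIV" for i
    unfolding p_def by (intro holomorphic_intros) (auto simp del: of_nat_Suc)
  have rec: "(w - 1) * D w = A K w + (\<Sum>i=1..K. p i w * ((w + of_nat i - 1) * D (w + of_nat i)))"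
    if w: "Re w > 1" for K w
  proof -
    have "(\<lambda>n. of_nat (Suc n) powr (- (w - 1))) \<longlonglongrightarrow> 0"
    proof (rule LIMSEQ_Suc [of "\<lambda>n. of_nat n powr (- (w - 1))"], rule tendsto_neg_powr_complex_of_nat)
      show "Re (- (w - 1)) < 0" using w by simp
    qed (rule filterlim_ident)
    hence "(\<lambda>n. nat_power (w - 1) n) \<longlonglongrightarrow> 0" by (simp add: nat_power_def)
    hence "(\<lambda>n. nat_power (w - 1) (Suc n) - nat_power (w - 1) n) sums (0 - nat_power (w - 1) 0)"
      by (rule telescope_sums)
    hence "(\<lambda>n. 1 * (nat_power (w - 1) (Suc n) - nat_power (w - 1) n)) sums (- 1)"
      by (simp add: nat_power_def)
    moreover have "(\<lambda>n. 1 * (nat_power (w - 1) (Suc n) - nat_power (w - 1) n)) sums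
        ((\<Sum>j=1..Suc K. (- (w - 1) gchoose j) * dirichlet_sum (\<lambda>_. 1) (w - 1 + of_nat j))
          + remainder_sum (\<lambda>_. 1) (Suc K) (w - 1))"
      by (rule nat_power_difference_sums) (use w in auto)
    ultimately have "- 1 = (\<Sum>j=1..Suc K. (- (w - 1) gchoose j) * D (w - 1 + of_nat j))
          + remainder_sum (\<lambda>_. 1) (Suc K) (w - 1)"
      unfolding D_def by (rule sums_unique2)
    hence "0 = 1 + remainder_sum (\<lambda>_. 1) (Suc K) (w - 1)
        + (\<Sum>j=1..Suc K. (- (w - 1) gchoose j) * D (w - 1 + of_nat j))"
      by algebra
    hence "0 = A K w + (\<Sum>j=1..Suc K. (1 - w gchoose j) * D (w - 1 + of_nat j))"
      by (simp only: A_def minus_diff_eq)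
    also have "(\<Sum>j=1..Suc K. (1 - w gchoose j) * D (w - 1 + of_nat j))
        = (\<Sum>i=0..K. (1 - w gchoose Suc i) * D (w + of_nat i))"
      by (rule sum.reindex_bij_witness [of _ Suc "\<lambda>j. j - 1"]) (auto simp: algebra_simps)
    also have "\<dots> = (1 - w) * D w + (\<Sum>i=1..K. (1 - w gchoose Suc i) * D (w + of_nat i))"
      by (simp add: sum.atLeast_Suc_atMost)
    also have "(\<Sum>i=1..K. (1 - w gchoose Suc i) * D (w + of_nat i))
        = (\<Sum>i=1..K. p i w * ((w + of_nat i - 1) * D (w + of_nat i)))"
    proof (rule sum.cong)
      fix i
      have "(1 - w gchoose Suc i) = (1 - w - of_nat i) * (1 - w gchoose i) / of_nat (Suc i)"
        using gbinomial_Suc_mult [of i "1 - w"] by (simp add: field_simps del: of_nat_Suc)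
      also have "\<dots> = p i w * (w + of_nat i - 1)"
        unfolding p_def by (simp add: divide_simps del: of_nat_Suc) (simp add: algebra_simps)
      finally show "(1 - w gchoose Suc i) * D (w + of_nat i)
          = p i w * ((w + of_nat i - 1) * D (w + of_nat i))" by (simp add: mult_ac)
    qed simp
    finally show ?thesis by (simp add: algebra_simps)
  qed
  show ?thesis
  proof (rule entire_extension [of A p "\<lambda>w. (w - 1) * D w", OF A p rec])
    fix F assume "F holomorphic_on UNIV" "\<And>w. Re w > 1 \<Longrightarrow> F w = (w - 1) * D w"
    thus thesis by (rule that [folded D_def])
  qed
qed

lemma open_punctured_plane: "open (- {1 :: complex})"
  by auto

lemma connected_punctured_plane: "connected (- {1 :: complex})"
  by (rule connected_punctured_universe) simp

lemma eq_on_punctured_plane: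
  assumes "f holomorphic_on - {1}" "g holomorphic_on - {1}"
    and "\<And>w. Re w > 1 \<Longrightarrow> f w = g w" and "z \<noteq> 1"
  shows "f z = g z"
proof (rule analytic_continuation_open [where f = f and g = g and s = "{w. Re w > 1}" and s' = "- {1}"])
  have "2 \<in> {w. Re w > 1}" by simp
  thus "{w. Re w > 1} \<noteq> {}" by blast
qed (use assms open_punctured_plane connected_punctured_plane in \<open>auto simp: open_halfspace_Re_gt\<close>)

text \<open>Existence is \<open>zeta_extension\<close> divided by \<open>w - 1\<close>, uniqueness is the identity theorem; together they
  turn the definite description into usable facts.\<close>
lemma riemann_zeta:
  "riemann_zeta holomorphic_on - {1}"
  "Re w > 1 \<Longrightarrow> (\<lambda>n. nat_power w n) sums riemann_zeta w"
proof -
  define P where "P = (\<lambda>f. f holomorphic_on - {1} \<and>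
     (\<forall>w. Re w > 1 \<longrightarrow> (\<lambda>n. of_nat (Suc n) powr (- w)) sums f w) \<and> f 1 = (0 :: complex))"
  obtain F where F: "F holomorphic_on UNIV"
    "\<And>w. Re w > 1 \<Longrightarrow> F w = (w - 1) * dirichlet_sum (\<lambda>_. 1) w"
    using zeta_extension by blast
  define f where "f = (\<lambda>w. if w = 1 then 0 else F w / (w - 1))"
  have "(\<lambda>w. F w / (w - 1)) holomorphic_on - {1}"
    by (intro holomorphic_intros holomorphic_on_subset [OF F(1)]) auto
  hence "f holomorphic_on - {1}"
    by (rule holomorphic_transform) (auto simp: f_def)
  moreover have "(\<lambda>n. of_nat (Suc n) powr (- w)) sums f w" if "Re w > 1" for w
  proof -
    have "f w = dirichlet_sum (\<lambda>_. 1) w" using that F(2) [OF that] by (auto simp: f_def)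
    thus ?thesis using dirichlet_sum_sums [of "\<lambda>_. 1" w] that
      by (simp add: nat_power_def)
  qed
  ultimately have "P f" by (simp add: P_def f_def)
  moreover have "g = f" if "P g" for g
  proof
    fix z
    show "g z = f z"
    proof (cases "z = 1")
      case False
      have "g w = f w" if w: "Re w > 1" for w
        using sums_unique2 [of "\<lambda>n. of_nat (Suc n) powr (- w)" "g w" "f w"] w \<open>P g\<close> \<open>P f\<close>
        by (simp add: P_def)
      with False show ?thesis using \<open>P g\<close> \<open>P f\<close> unfolding P_def
        by (intro eq_on_punctured_plane [of g f z]) blast+
    qed (use that \<open>P f\<close> in \<open>simp add: P_def\<close>)
  qed
  ultimately have "P (THE f. P f)" by (rule theI)
  hence "P riemann_zeta" unfolding riemann_zeta_def P_def .
  thus "riemann_zeta holomorphic_on - {1}"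
    "Re w > 1 \<Longrightarrow> (\<lambda>n. nat_power w n) sums riemann_zeta w"
    by (simp_all add: P_def nat_power_def)
qed

text \<open>The alternating series is the full series minus twice its even-numbered terms, and these are
  \<open>2 powr - w\<close> times the full series. In the indexing from \<open>0\<close>, the terms at odd positions are the
  ones with an even base.\<close>
lemma eta_sums_zeta:
  assumes "Re w > 1"
  shows "(\<lambda>n. (- 1) ^ n * nat_power w n) sums ((1 - 2 powr (1 - w)) * riemann_zeta w)"
proof -
  have Z: "(\<lambda>n. nat_power w n) sums riemann_zeta w" by (rule riemann_zeta) fact
  have dbl: "nat_power w (Suc (2 * m)) = 2 powr (- w) * nat_power w m" for m
  proof -
    have "of_nat (Suc (Suc (2 * m))) = (2 * of_nat (Suc m) :: complex)" by simp
    thus ?thesis unfolding nat_power_def by (simp only: powr_times_real) (subst powr_times_real, auto)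
  qed
  have "(\<lambda>m. if even (Suc (2 * m)) then 0 else nat_power w (Suc (2 * m))) sums (2 powr (- w) * riemann_zeta w)"
    using sums_mult [OF Z, of "2 powr (- w)"] by (simp add: dbl)
  hence "(\<lambda>n. if even n then 0 else nat_power w n) sums (2 powr (- w) * riemann_zeta w)"
    by (subst (asm) sums_mono_reindex [of "\<lambda>m. Suc (2 * m)"]) (auto simp: strict_mono_def elim!: oddE)
  hence "(\<lambda>n. nat_power w n - 2 * (if even n then 0 else nat_power w n))
      sums (riemann_zeta w - 2 * (2 powr (- w) * riemann_zeta w))"
    by (intro sums_diff [OF Z] sums_mult)
  also have "(\<lambda>n. nat_power w n - 2 * (if even n then 0 else nat_power w n)) = (\<lambda>n. (- 1) ^ n * nat_power w n)"
    by auto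
  also have "riemann_zeta w - 2 * (2 powr (- w) * riemann_zeta w) = (1 - 2 powr (1 - w)) * riemann_zeta w"
    by (simp add: powr_diff powr_minus field_simps)
  finally show ?thesis .
qed

text \<open>Both sides of \<open>\<eta>(w) = (1 - 2 powr (1 - w)) \<zeta>(w)\<close> are holomorphic off \<open>1\<close> and agree for \<open>Re w > 1\<close>.\<close>
lemma riemann_zeta_neg_of_nat:
  "(1 - 2 ^ Suc s) * riemann_zeta (- of_nat s) = of_real (abel_eta s)"
proof -
  obtain eta where eta: "eta holomorphic_on UNIV"
    "\<And>w. Re w > 1 \<Longrightarrow> (\<lambda>n. (- 1) ^ n * nat_power w n) sums eta w"
    "\<And>s. eta (- of_nat s) = of_real (abel_eta s)"
    by (rule eta_extension) blast
  have "eta (- of_nat s) = (1 - 2 powr (1 - (- of_nat s))) * riemann_zeta (- of_nat s)"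
  proof (rule eq_on_punctured_plane [where f = eta and g = "\<lambda>w. (1 - 2 powr (1 - w)) * riemann_zeta w"])
    show "eta holomorphic_on - {1}" using eta(1) by (rule holomorphic_on_subset) simp
    show "(\<lambda>w. (1 - 2 powr (1 - w)) * riemann_zeta w) holomorphic_on - {1}"
      by (intro holomorphic_intros riemann_zeta)
    show "eta w = (1 - 2 powr (1 - w)) * riemann_zeta w" if "Re w > 1" for w
      using eta(2) [OF that] eta_sums_zeta [OF that] by (rule sums_unique2)
    have "Re (- of_nat s) \<noteq> Re (1 :: complex)" by simp
    thus "- of_nat s \<noteq> (1 :: complex)" by metis
  qed
  moreover have "2 powr (1 - (- of_nat s)) = (2 :: complex) ^ Suc s"
    using powr_nat' [of "2 :: complex" "Suc s"] by simp
  ultimately show ?thesis using eta(3) by simp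
qed

section \<open>The formal identity and the value at a negative integer\<close>

theorem theorem1:
  fixes s :: nat
  assumes "s \<ge> 1"
  shows "(fps_of_poly (Upsilon s) / (1 - fps_X) ^ (s + 1)
            - 2 ^ (s + 1) * (fps_of_poly (Lambda s) / ((1 - fps_X) ^ (s + 1) * (1 + fps_X) ^ (s + 1)))
          = (fps_of_poly (xi s) / (1 + fps_X) ^ (s + 1) :: real fps)) \<and>
         (\<forall>g h :: real fps.
            g = fps_of_poly (Upsilon s) * inverse ((1 - fps_X) ^ (s + 1)) \<longrightarrow>
            h = fps_of_poly (Lambda s) * inverse ((1 - fps_X) ^ (s + 1)) * inverse ((1 + fps_X) ^ (s + 1)) \<longrightarrow>
            g - 2 ^ (s + 1) * h = fps_of_poly (xi s) * inverse ((1 + fps_X) ^ (s + 1))) \<and>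
         (\<forall>C :: real.
            C - 2 ^ (s + 1) * C = poly (xi s) 1 / 2 ^ (s + 1) \<longleftrightarrow>
            C = poly (xi s) 1 / (2 ^ (s + 1) * (1 - 2 ^ (s + 1)))) \<and>
         (\<forall>C :: real.
            C - 2 ^ (s + 1) * C = poly (xi s) 1 / 2 ^ (s + 1) \<longrightarrow>
            complex_of_real C = riemann_zeta (- of_nat s))"
proof -
  define M P :: "real fps" where "M = (1 - fps_X) ^ (s + 1)" and "P = (1 + fps_X) ^ (s + 1)"
  define h where "h = fps_X * (power_series s oo fps_X ^ 2)"
  define x where "x = Abs_fps (\<lambda>n. (- 1) ^ n * real (Suc n) ^ s)"
  have M0: "fps_nth M 0 \<noteq> 0" and P0: "fps_nth P 0 \<noteq> 0"
    by (simp_all add: M_def P_def fps_power_zeroth del: power_Suc)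
  hence MP0: "fps_nth (M * P) 0 \<noteq> 0" by simp
  have cancel: "u * f * inverse u = f" if "fps_nth u 0 \<noteq> 0" for u f :: "real fps"
    using inverse_mult_eq_1 [OF that] by (simp add: mult.assoc mult.left_commute mult.commute)
  have U: "fps_of_poly (Upsilon s) = M * power_series s"
    and L: "fps_of_poly (Lambda s) = M * P * h"
    and X: "fps_of_poly (xi s) = P * x"
    using Upsilon_eq_power_series [OF assms] Lambda_eq_power_series [OF assms] xi_eq_power_series [OF assms]
    by (simp_all only: M_def P_def h_def x_def)
  have LI: "M * P * h * inverse M * inverse P = h"
    using cancel [OF MP0, of h] by (simp add: fps_inverse_mult mult_ac)
  have signs: "power_series s - 2 ^ (s + 1) * h = x"
    unfolding h_def x_def by (rule power_series_signs)
  have 1: "fps_of_poly (Upsilon s) / M - 2 ^ (s + 1) * (fps_of_poly (Lambda s) / (M * P))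
      = fps_of_poly (xi s) / P"
    using signs by (simp only: fps_divide_unit [OF M0] fps_divide_unit [OF P0] fps_divide_unit [OF MP0]
        U L X cancel [OF M0] cancel [OF P0] cancel [OF MP0])
  have 2: "g - 2 ^ (s + 1) * h' = fps_of_poly (xi s) * inverse P"
    if "g = fps_of_poly (Upsilon s) * inverse M" "h' = fps_of_poly (Lambda s) * inverse M * inverse P"
    for g h' :: "real fps"
    using signs by (simp only: that U L X cancel [OF M0] cancel [OF P0] LI)
  have "(1 :: real) < 2 ^ (s + 1)" by (rule one_less_power) auto
  hence ne: "1 - 2 ^ (s + 1) \<noteq> (0 :: real)" by simp
  have 3: "C - 2 ^ (s + 1) * C = poly (xi s) 1 / 2 ^ (s + 1) \<longleftrightarrow>
      C = poly (xi s) 1 / (2 ^ (s + 1) * (1 - 2 ^ (s + 1)))" for C :: real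
  proof -
    have "C - 2 ^ (s + 1) * C = C * (1 - 2 ^ (s + 1))" by (simp add: algebra_simps)
    thus ?thesis using ne by (simp only: divide_divide_eq_left [symmetric] eq_divide_eq) simp
  qed
  have 4: "complex_of_real C = riemann_zeta (- of_nat s)"
    if "C - 2 ^ (s + 1) * C = poly (xi s) 1 / 2 ^ (s + 1)" for C :: real
  proof -
    have "(1 - 2 ^ (s + 1)) * C = abel_eta s"
      using that poly_xi_1 [OF assms] by (simp add: algebra_simps)
    hence "of_real ((1 - 2 ^ (s + 1)) * C) = (1 - 2 ^ Suc s) * riemann_zeta (- of_nat s)"
      by (simp only: riemann_zeta_neg_of_nat)
    also have "of_real ((1 - 2 ^ (s + 1)) * C) = (1 - 2 ^ Suc s) * complex_of_real C" by simp
    finally have "(1 - 2 ^ Suc s) * complex_of_real C = (1 - 2 ^ Suc s) * riemann_zeta (- of_nat s)" .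
    moreover have "(1 - 2 ^ Suc s :: complex) \<noteq> 0"
    proof -
      have "complex_of_real (1 - 2 ^ (s + 1)) \<noteq> 0" using ne by (simp only: of_real_eq_0_iff) simp
      thus ?thesis by simp
    qed
    ultimately show ?thesis using mult_left_cancel by blast
  qed
  show ?thesis using 1 2 3 4 unfolding M_def P_def by blast
qed

end
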